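(* Let $\mathbf{x}_1,\mathbf{y}_1\in\mathbb{R}^{d_1}$, $\mathbf{x}_2,\mathbf{y}_2\in\mathbb{R}^{d_2}$ and $\mathbf{x}_3,\mathbf{y}_3\in\mathbb{R}^{d_3}$ be vectors such that each pair $\mathbf{x}_i,\mathbf{y}_i$ is linearly independent. Then the tensor $$A:=\mathbf{x}_1\otimes\mathbf{x}_2\otimes\mathbf{y}_3+\mathbf{x}_1\otimes\mathbf{y}_2\otimes\mathbf{x}_3+\mathbf{y}_1\otimes\mathbf{x}_2\otimes\mathbf{x}_3\in\mathbb{R}^{d_1\times d_2\times d_3}$$ has rank $3$ but can be approximated arbitrarily closely by tensors of rank $2$. In particular, $A$ does not have a best rank-$2$ approximation, i.e. $\inf\{\|A-B\|:\operatorname{rank}_\otimes(B)\le2\}$ is not attained.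
   Context: $\mathbb{R}^{d_1\times d_2\times d_3}\cong\mathbb{R}^{d_1}\otimes\mathbb{R}^{d_2}\otimes\mathbb{R}^{d_3}$ is the space of real 3-way arrays, equipped with a norm (all norms induce the same topology); $\mathbf{x}\otimes\mathbf{y}\otimes\mathbf{z}$ is the array with entries $x_iy_jz_k$ (a decomposable tensor). Rank means outer-product rank: $\operatorname{rank}_{\otimes}(A)$ is the least $r\ge 0$ such that $A$ is a sum of $r$ decomposable tensors. *)

theory Defs
  imports "HOL-Analysis.Analysis"
begin

text \<open>A real $d_1 \times d_2 \times d_3$ array has type
  \<^typ>\<open>real ^ 'd3 ^ 'd2 ^ 'd1\<close>, so that its \<open>(i, j, k)\<close> entry is \<open>A $ i $ j $ k\<close>.\<close>

type_synonym ('d1, 'd2, 'd3) tensor3 = "real ^ 'd3 ^ 'd2 ^ 'd1"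

definition outer3 ::
    "real ^ 'd1 \<Rightarrow> real ^ 'd2 \<Rightarrow> real ^ 'd3 \<Rightarrow> ('d1::finite, 'd2::finite, 'd3::finite) tensor3"
  where "outer3 x y z = (\<chi> i j k. x $ i * y $ j * z $ k)"

definition tensor_rank :: "('d1::finite, 'd2::finite, 'd3::finite) tensor3 \<Rightarrow> nat"
  where "tensor_rank A = (LEAST r. \<exists>x y z. A = (\<Sum>l<r. outer3 (x l) (y l) (z l)))"

text \<open>The class operation \<^const>\<open>norm\<close> on arrays is the Frobenius norm; the predicate below
  allows statements about an arbitrary norm.\<close>

definition is_norm :: "('v::real_vector \<Rightarrow> real) \<Rightarrow> bool"
  where "is_norm N \<longleftrightarrow>
    (\<forall>v. N v \<ge> 0) \<and>
    (\<forall>v. N v = 0 \<longleftrightarrow> v = 0) \<and>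
    (\<forall>c v. N (c *\<^sub>R v) = \<bar>c\<bar> * N v) \<and>
    (\<forall>v w. N (v + w) \<le> N v + N w)"

end

theory Submission
  imports Defs
begin

text \<open>Pairing a tensor with decomposable tensors built from vectors dual to $x_i, y_i$ turns a
  decomposition of \<open>A\<close> into two terms into one of the \<open>2 \<times> 2 \<times> 2\<close> tensor with slices
  $T_0 = (0, 1; 1, 0)$ and $T_1 = (1, 0; 0, 0)$. The pencil $\det (s T_0 + t T_1) = -s^2$
  would then factor as $D (s c_0 + t c_1)(s c'_0 + t c'_1)$, which forces $c_1 = c'_1 = 0$
  and so $T_1 = 0$, which is absurd. On the other hand \<open>A\<close> is the derivative at \<open>t = 0\<close> of
  $(x_1 + t y_1) \otimes (x_2 + t y_2) \otimes (x_3 + t y_3)$, hence a limit of difference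
  quotients, which have rank 2.\<close>

section \<open>Pairings of decomposable tensors\<close>

lemma outer3_zero_left [simp]: "outer3 0 y z = 0"
  by (simp add: outer3_def vec_eq_iff)

lemma inner_outer3:
  "outer3 x y z \<bullet> outer3 u v w = (x \<bullet> u) * (y \<bullet> v) * (z \<bullet> w)"
proof -
  have "outer3 x y z \<bullet> outer3 u v w
      = (\<Sum>i\<in>UNIV. \<Sum>j\<in>UNIV. \<Sum>k\<in>UNIV. (x $ i * u $ i) * ((y $ j * v $ j) * (z $ k * w $ k)))"
    by (simp add: outer3_def inner_vec_def mult_ac)
  also have "\<dots> = (x \<bullet> u) * ((y \<bullet> v) * (z \<bullet> w))"
    by (simp add: inner_vec_def flip: sum_distrib_left sum_distrib_right)
  finally show ?thesis
    by (simp add: mult.assoc)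
qed

section \<open>Existence of decompositions and subadditivity of rank\<close>

lemma tensor_eq_sum_outer3_axis:
  fixes A :: "('d1::finite, 'd2::finite, 'd3::finite) tensor3"
  shows "A = (\<Sum>(i, j, k)\<in>UNIV. outer3 (axis i (A $ i $ j $ k)) (axis j 1) (axis k 1))"
proof -
  have "(\<Sum>(i, j, k)\<in>UNIV. outer3 (axis i (A $ i $ j $ k)) (axis j 1) (axis k 1)) $ a $ b $ c
      = A $ a $ b $ c" for a b c
  proof -
    have "(\<Sum>(i, j, k)\<in>UNIV. outer3 (axis i (A $ i $ j $ k)) (axis j 1) (axis k 1)) $ a $ b $ c
        = (\<Sum>p\<in>UNIV. if p = (a, b, c) then A $ a $ b $ c else 0)"
      unfolding sum_component
      by (intro sum.cong) (auto simp: outer3_def axis_def split: if_splits)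
    then show ?thesis
      by simp
  qed
  then show ?thesis
    by (simp add: vec_eq_iff)
qed

text \<open>Enumerating the index triples turns the expansion in the standard basis into a sum over
  an initial segment of the naturals. This makes the \<open>LEAST\<close> in
  \<open>tensor_rank\<close> well defined.\<close>

lemma ex_sum_outer3:
  fixes A :: "('d1::finite, 'd2::finite, 'd3::finite) tensor3"
  shows "\<exists>(r :: nat) x y z. A = (\<Sum>l<r. outer3 (x l) (y l) (z l))"
proof -
  let ?n = "CARD('d1 \<times> 'd2 \<times> 'd3)"
  obtain h where h: "bij_betw h {0..<?n} (UNIV :: ('d1 \<times> 'd2 \<times> 'd3) set)"
    using ex_bij_betw_nat_finite[OF finite_class.finite_UNIV] by blast
  have "A = (\<Sum>(i, j, k)\<in>UNIV. outer3 (axis i (A $ i $ j $ k)) (axis j 1) (axis k 1))"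
    by (rule tensor_eq_sum_outer3_axis)
  also have "\<dots> = (\<Sum>l<?n. case h l of (i, j, k) \<Rightarrow>
      outer3 (axis i (A $ i $ j $ k)) (axis j 1) (axis k 1))"
    unfolding lessThan_atLeast0 by (rule sum.reindex_bij_betw[OF h, symmetric])
  also have "\<dots> = (\<Sum>l<?n. outer3
      (case h l of (i, j, k) \<Rightarrow> axis i (A $ i $ j $ k))
      (case h l of (i, j, k) \<Rightarrow> axis j 1) (case h l of (i, j, k) \<Rightarrow> axis k 1))"
    by (intro sum.cong) (auto split: prod.splits)
  finally show ?thesis
    by (intro exI)
qed

lemma tensor_rank_le_iff:
  "tensor_rank A \<le> r \<longleftrightarrow> (\<exists>x y z. A = (\<Sum>l<r. outer3 (x l) (y l) (z l)))"
proof
  assume le: "tensor_rank A \<le> r"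
  have "\<exists>x y z. A = (\<Sum>l<tensor_rank A. outer3 (x l) (y l) (z l))"
    unfolding tensor_rank_def by (rule LeastI_ex) (rule ex_sum_outer3)
  then obtain x y z where A: "A = (\<Sum>l<tensor_rank A. outer3 (x l) (y l) (z l))"
    by auto
  \<comment> \<open>Padding: a zero first factor makes each surplus term vanish, so a shortest
    decomposition extends to one of length \<open>r\<close>.\<close>
  define x' where "x' l = (if l < tensor_rank A then x l else 0)" for l
  have "(\<Sum>l<r. outer3 (x' l) (y l) (z l)) = (\<Sum>l<tensor_rank A. outer3 (x' l) (y l) (z l))"
    using le by (intro sum.mono_neutral_right) (auto simp: x'_def)
  also have "\<dots> = A"
    by (subst (2) A) (simp add: x'_def)
  finally show "\<exists>x y z. A = (\<Sum>l<r. outer3 (x l) (y l) (z l))"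
    by metis
next
  assume "\<exists>x y z. A = (\<Sum>l<r. outer3 (x l) (y l) (z l))"
  then show "tensor_rank A \<le> r"
    unfolding tensor_rank_def by (rule Least_le)
qed

lemma tensor_rank_outer3_le: "tensor_rank (outer3 x y z) \<le> 1"
  unfolding tensor_rank_le_iff by (intro exI[of _ "\<lambda>_. _"]) simp

lemma tensor_rank_add_le:
  fixes A B :: "('d1::finite, 'd2::finite, 'd3::finite) tensor3"
  shows "tensor_rank (A + B) \<le> tensor_rank A + tensor_rank B"
proof -
  let ?m = "tensor_rank A" and ?n = "tensor_rank B"
  obtain x y z where A: "A = (\<Sum>l<?m. outer3 (x l) (y l) (z l))"
    using tensor_rank_le_iff[of A ?m] by auto
  obtain x' y' z' where B: "B = (\<Sum>l<?n. outer3 (x' l) (y' l) (z' l))"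
    using tensor_rank_le_iff[of B ?n] by auto
  have split: "(\<Sum>l<m + n. f l) = (\<Sum>l<m. f l) + (\<Sum>l<n. f (m + l))"
    for m n and f :: "nat \<Rightarrow> ('d1, 'd2, 'd3) tensor3"
    by (induction n) (simp_all add: add.assoc)
  have "A + B = (\<Sum>l<?m + ?n. outer3 (if l < ?m then x l else x' (l - ?m))
      (if l < ?m then y l else y' (l - ?m)) (if l < ?m then z l else z' (l - ?m)))"
    using arg_cong2[OF A B, of "(+)"] unfolding split by simp
  then show ?thesis
    unfolding tensor_rank_le_iff by (intro exI) assumption
qed

lemma tensor_rank_le_1_cases:
  assumes "tensor_rank A \<le> 1"
  obtains a b c where "A = outer3 a b c"
  using assms unfolding tensor_rank_le_iff by auto

lemma tensor_rank_le_2_cases: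
  assumes "tensor_rank A \<le> 2"
  obtains a b c a' b' c' where "A = outer3 a b c + outer3 a' b' c'"
  using assms unfolding tensor_rank_le_iff by (auto simp: numeral_2_eq_2)

section \<open>Obstruction to two-term decompositions\<close>

lemma independent_pair_dual:
  fixes x y :: "'a::euclidean_space"
  assumes "x \<noteq> y" "independent {x, y}"
  obtains u where "x \<bullet> u = 1" "y \<bullet> u = 0"
proof -
  have "\<exists>f. linear f \<and> (\<forall>v\<in>{x, y}. f v = (if v = x then 1 else 0 :: real))"
    by (rule linear_independent_extend[OF assms(2)])
  then obtain f where f: "linear f" "f x = 1" "f y = (0 :: real)"
    using assms(1) by auto
  \<comment> \<open>The vector representing the functional \<open>f\<close> is its adjoint applied
    to 1.\<close>
  have "f v = v \<bullet> adjoint f 1" for v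
    using adjoint_works[OF f(1), of v 1] by simp
  then show thesis
    using f that by metis
qed

text \<open>The third index selects the slice. Slice k factors as M diag(ck, ck') L, where M has
  columns (a0, a1), (a0', a1') and L has rows (b0, b1), (b0', b1'). Its determinant is thus
  \<open>D\<close> times ck ck', with \<open>D\<close> = det M det L.\<close>

lemma no_two_term_decomposition:
  fixes a0 a1 b0 b1 c0 c1 a0' a1' b0' b1' c0' c1' :: real
  assumes "a0 * b0 * c0 + a0' * b0' * c0' = 0"
    and "a0 * b1 * c0 + a0' * b1' * c0' = 1"
    and "a1 * b0 * c0 + a1' * b0' * c0' = 1"
    and "a1 * b1 * c0 + a1' * b1' * c0' = 0"
    and "a0 * b0 * c1 + a0' * b0' * c1' = 1"
    and "a0 * b1 * c1 + a0' * b1' * c1' = 0"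
    and "a1 * b0 * c1 + a1' * b0' * c1' = 0"
    and "a1 * b1 * c1 + a1' * b1' * c1' = 0"
  shows False
proof -
  define D where "D = (a0 * a1' - a1 * a0') * (b0 * b1' - b1 * b0')"
  have "D * (c0 * c0') = (a0 * b0 * c0 + a0' * b0' * c0') * (a1 * b1 * c0 + a1' * b1' * c0')
      - (a0 * b1 * c0 + a0' * b1' * c0') * (a1 * b0 * c0 + a1' * b0' * c0')"
    unfolding D_def by algebra
  then have D0: "D * (c0 * c0') = - 1"
    by (simp only: assms)
  have "D * (c1 * c1') = (a0 * b0 * c1 + a0' * b0' * c1') * (a1 * b1 * c1 + a1' * b1' * c1')
      - (a0 * b1 * c1 + a0' * b1' * c1') * (a1 * b0 * c1 + a1' * b0' * c1')"
    unfolding D_def by algebra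
  then have D1: "D * (c1 * c1') = 0"
    by (simp only: assms)
  \<comment> \<open>This is the coefficient of s t in the determinant of the pencil.\<close>
  have "D * (c0 * c1' + c1 * c0')
      = (a0 * b0 * c0 + a0' * b0' * c0') * (a1 * b1 * c1 + a1' * b1' * c1')
      + (a0 * b0 * c1 + a0' * b0' * c1') * (a1 * b1 * c0 + a1' * b1' * c0')
      - (a0 * b1 * c0 + a0' * b1' * c0') * (a1 * b0 * c1 + a1' * b0' * c1')
      - (a0 * b1 * c1 + a0' * b1' * c1') * (a1 * b0 * c0 + a1' * b0' * c0')"
    unfolding D_def by algebra
  then have D01: "D * (c0 * c1' + c1 * c0') = 0"
    by (simp only: assms)
  have "D \<noteq> 0" "c0 \<noteq> 0" "c0' \<noteq> 0"
    using D0 by auto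
  \<comment> \<open>\<open>D1\<close> kills one of \<open>c1\<close>, \<open>c1'\<close>; then
    \<open>D01\<close> kills the other.\<close>
  with D1 D01 have "c1 = 0" "c1' = 0"
    by auto
  then show False
    using assms(5) by simp
qed

theorem proposition4p6:
  fixes x1 y1 :: "real ^ 'd1::finite"
    and x2 y2 :: "real ^ 'd2::finite"
    and x3 y3 :: "real ^ 'd3::finite"
    and A :: "('d1, 'd2, 'd3) tensor3"
    and N :: "('d1, 'd2, 'd3) tensor3 \<Rightarrow> real"
  assumes "x1 \<noteq> y1" and "independent {x1, y1}"
    and "x2 \<noteq> y2" and "independent {x2, y2}"
    and "x3 \<noteq> y3" and "independent {x3, y3}"
    and "A = outer3 x1 x2 y3 + outer3 x1 y2 x3 + outer3 y1 x2 x3"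
    and "is_norm N"
  shows "tensor_rank A = 3
    \<and> (\<forall>\<epsilon>>0. \<exists>B. tensor_rank B = 2 \<and> N (A - B) < \<epsilon>)
    \<and> \<not> (\<exists>B. tensor_rank B \<le> 2 \<and> N (A - B) = (INF C\<in>{C. tensor_rank C \<le> 2}. N (A - C)))"
proof -
  obtain u1 where u1: "x1 \<bullet> u1 = 1" "y1 \<bullet> u1 = 0"
    using assms(1,2) by (rule independent_pair_dual)
  obtain u2 where u2: "x2 \<bullet> u2 = 1" "y2 \<bullet> u2 = 0"
    using assms(3,4) by (rule independent_pair_dual)
  obtain u3 where u3: "x3 \<bullet> u3 = 1" "y3 \<bullet> u3 = 0"
    using assms(5,6) by (rule independent_pair_dual)
  obtain v1 where v1: "y1 \<bullet> v1 = 1" "x1 \<bullet> v1 = 0"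
    using independent_pair_dual[of y1 x1] assms(1,2) by (metis insert_commute)
  obtain v2 where v2: "y2 \<bullet> v2 = 1" "x2 \<bullet> v2 = 0"
    using independent_pair_dual[of y2 x2] assms(3,4) by (metis insert_commute)
  obtain v3 where v3: "y3 \<bullet> v3 = 1" "x3 \<bullet> v3 = 0"
    using independent_pair_dual[of y3 x3] assms(5,6) by (metis insert_commute)
  note dual = u1 u2 u3 v1 v2 v3
  have N_nonneg: "N v \<ge> 0" and N_zero: "N v = 0 \<longleftrightarrow> v = 0"
    and N_scale: "N (c *\<^sub>R v) = \<bar>c\<bar> * N v" and N_add: "N (v + w) \<le> N v + N w" for v w c
    using assms(8) unfolding is_norm_def by auto

  have not_le_2: "\<not> tensor_rank A \<le> 2"
  proof
    assume "tensor_rank A \<le> 2"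
    then obtain a b c a' b' c' where "A = outer3 a b c + outer3 a' b' c'"
      by (rule tensor_rank_le_2_cases)
    then have pairing: "(a \<bullet> f) * (b \<bullet> g) * (c \<bullet> h) + (a' \<bullet> f) * (b' \<bullet> g) * (c' \<bullet> h)
        = (x1 \<bullet> f) * (x2 \<bullet> g) * (y3 \<bullet> h) + (x1 \<bullet> f) * (y2 \<bullet> g) * (x3 \<bullet> h)
          + (y1 \<bullet> f) * (x2 \<bullet> g) * (x3 \<bullet> h)" for f g h
      unfolding inner_outer3[symmetric] inner_add_left[symmetric] using assms(7) by simp
    show False
      \<comment> \<open>Index 0 stands for pairing with \<open>u1\<close>, \<open>u2\<close>,
        \<open>u3\<close> and index 1 for pairing with \<open>v1\<close>, \<open>v2\<close>,
        \<open>v3\<close>.\<close>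
      by (rule no_two_term_decomposition[of "a \<bullet> u1" "b \<bullet> u2" "c \<bullet> u3" "a' \<bullet> u1" "b' \<bullet> u2" "c' \<bullet> u3"
            "b \<bullet> v2" "b' \<bullet> v2" "a \<bullet> v1" "a' \<bullet> v1" "c \<bullet> v3" "c' \<bullet> v3"])
        (simp_all add: pairing dual)
  qed
  have "tensor_rank A \<le> 3"
    unfolding assms(7)
    using tensor_rank_add_le[of "outer3 x1 x2 y3 + outer3 x1 y2 x3" "outer3 y1 x2 x3"]
      tensor_rank_add_le[of "outer3 x1 x2 y3" "outer3 x1 y2 x3"]
      tensor_rank_outer3_le[of x1 x2 y3] tensor_rank_outer3_le[of x1 y2 x3]
      tensor_rank_outer3_le[of y1 x2 x3]
    by linarith
  with not_le_2 have rank: "tensor_rank A = 3"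
    by linarith

  \<comment> \<open>Approximation by tensors of rank 2\<close>
  have approx: "\<exists>B. tensor_rank B = 2 \<and> N (A - B) < \<epsilon>" if "\<epsilon> > 0" for \<epsilon>
  proof -
    \<comment> \<open>\<open>P\<close> and \<open>Q\<close> are the coefficients of t^2 and t^3 in
      the expansion of the product of the vectors xi + t yi; the coefficient of t is
      \<open>A\<close>.\<close>
    define P where "P = outer3 x1 y2 y3 + outer3 y1 x2 y3 + outer3 y1 y2 x3"
    define Q where "Q = outer3 y1 y2 y3"
    \<comment> \<open>The bound 1 gives t^2 \<le> t, and the summand 1 in the denominator keeps it
      positive and makes the final estimate strict.\<close>
    define t where "t = min 1 (\<epsilon> / (N P + N Q + 1))"
    have pos: "N P + N Q + 1 > 0"
      using N_nonneg[of P] N_nonneg[of Q] by linarith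
    then have t: "0 < t" "t \<le> 1" "t \<le> \<epsilon> / (N P + N Q + 1)"
      using that by (auto simp: t_def)
    \<comment> \<open>The difference quotient, with the scalar 1/t absorbed into the first
      factors.\<close>
    define B where "B = outer3 ((1 / t) *\<^sub>R (x1 + t *\<^sub>R y1)) (x2 + t *\<^sub>R y2) (x3 + t *\<^sub>R y3)
      + outer3 ((- 1 / t) *\<^sub>R x1) x2 x3"
    have B: "B = A + t *\<^sub>R (P + t *\<^sub>R Q)"
      using t(1) by (simp add: B_def assms(7) P_def Q_def outer3_def vec_eq_iff field_simps)

    have "\<not> tensor_rank B \<le> 1"
    proof
      assume "tensor_rank B \<le> 1"
      then obtain a b c where "B = outer3 a b c"
        by (rule tensor_rank_le_1_cases)
      then have pairing: "(a \<bullet> f) * (b \<bullet> g) * (c \<bullet> h) = B \<bullet> outer3 f g h" for f g h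
        by (simp add: inner_outer3)
      \<comment> \<open>Each term of \<open>P\<close> and \<open>Q\<close> has at least two factors
        yi, so it pairs to 0 when at most one ui is replaced by vi. The last two products force all
        three factors of the first to be nonzero.\<close>
      have "(a \<bullet> u1) * (b \<bullet> u2) * (c \<bullet> u3) = 0" "(a \<bullet> u1) * (b \<bullet> u2) * (c \<bullet> v3) = 1"
        "(a \<bullet> u1) * (b \<bullet> v2) * (c \<bullet> u3) = 1"
        unfolding pairing B P_def Q_def assms(7)
        by (simp_all add: inner_add_left inner_outer3 dual)
      then show False
        by auto
    qed
    moreover have "tensor_rank B \<le> 2"
      unfolding B_def
      by (rule order_trans[OF tensor_rank_add_le])
        (use tensor_rank_outer3_le in \<open>metis add_mono one_add_one\<close>)
    ultimately have "tensor_rank B = 2"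
      by linarith
    moreover have "N (A - B) < \<epsilon>"
    proof -
      have "N (A - B) = N ((- t) *\<^sub>R (P + t *\<^sub>R Q))"
        by (simp add: B)
      also have "\<dots> \<le> t * (N P + t * N Q)"
        using N_add[of P "t *\<^sub>R Q"] t(1) unfolding N_scale by simp
      also have "\<dots> \<le> t * (N P + N Q)"
        using t N_nonneg[of Q] by (simp add: mult_left_le_one_le)
      also have "\<dots> < t * (N P + N Q + 1)"
        using t(1) by simp
      also have "\<dots> \<le> \<epsilon>"
        using t(3) pos by (simp add: pos_le_divide_eq)
      finally show ?thesis .
    qed
    ultimately show ?thesis
      by blast
  qed

  have "\<not> (\<exists>B. tensor_rank B \<le> 2 \<and> N (A - B) = (INF C\<in>{C. tensor_rank C \<le> 2}. N (A - C)))"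
  proof
    assume "\<exists>B. tensor_rank B \<le> 2 \<and> N (A - B) = (INF C\<in>{C. tensor_rank C \<le> 2}. N (A - C))"
    then obtain B where B: "tensor_rank B \<le> 2"
      and min: "N (A - B) = (INF C\<in>{C. tensor_rank C \<le> 2}. N (A - C))"
      by blast
    have bdd: "bdd_below ((\<lambda>C. N (A - C)) ` {C. tensor_rank C \<le> 2})"
      using N_nonneg by (auto intro: bdd_belowI2[where m = 0])
    have "N (A - B) \<le> N (A - C)" if "tensor_rank C = 2" for C
      unfolding min using that by (intro cINF_lower[OF bdd]) simp
    \<comment> \<open>A minimizer at positive distance would be beaten by an approximant closer than
      that distance. So the infimum could only be attained at \<open>A\<close> itself, whose rank is
      too large.\<close>
    then have "N (A - B) \<noteq> 0 \<Longrightarrow> False"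
      using approx[of "N (A - B)"] N_nonneg[of "A - B"] by force
    then have "A = B"
      using N_zero by auto
    with B not_le_2 show False
      by simp
  qed
  with rank approx show ?thesis
    by blast
qed

end
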